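(* Let $N$ be a positive integer. Then $$\sum_{n=0}^{N}\frac{(q\sqrt{k},-q\sqrt{k},y,z,k^2q^{N}/(yz),q^{-N};q)_n\,(n+1)\,q^n}{(\sqrt{k},-\sqrt{k},qk/y,qk/z,yzq^{1-N}/k,kq^{1+N};q)_n}$$ $$=\frac{(1-k/y)(1-k/z)(1-kq^N)(1-kq^N/(yz))}{(1-k)(1-k/(yz))(1-kq^N/y)(1-kq^N/z)}\sum_{n=0}^{N}\frac{(y,z,k^2q^{N}/(yz),q^{-N};q)_{n}}{(k/y,k/z,kq^{N},yzq^{-N}/k;q)_{n}}.$$
   Context: For an integer $n\ge 0$, $(x;q)_n=\prod_{i=0}^{n-1}(1-xq^i)$ and $(x_1,\dots,x_m;q)_n=\prod_{j=1}^m(x_j;q)_n$. Here $q,k,y,z$ are nonzero complex numbers such that none of the denominators vanish, and $\sqrt k$ is a fixed square root of $k$. *)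

theory Defs
  imports Complex_Main
begin

definition qpoch :: "complex \<Rightarrow> complex \<Rightarrow> nat \<Rightarrow> complex" where
  "qpoch x q n = (\<Prod>i<n. 1 - x * q ^ i)"

definition qpochs :: "complex list \<Rightarrow> complex \<Rightarrow> nat \<Rightarrow> complex" where
  "qpochs xs q n = (\<Prod>x\<leftarrow>xs. qpoch x q n)"

end

theory Submission
  imports Defs
begin

text \<open>
  Put \<open>w = k\<^sup>2 q\<^sup>N / (y z)\<close> and \<open>v = q\<^sup>-\<^sup>N\<close>, so that \<open>y z w v = k\<^sup>2\<close>, and let
  \<open>U n = (y, z, w, v; q)\<^sub>n / (k/y, k/z, k/w, k/v; q)\<^sub>n\<close> be the summand on the right. Because of the
  balancing condition, the summand on the left without its factor \<open>n + 1\<close> is a constant multiple of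
  \<open>U n - U (n + 1)\<close>. Since \<open>U (N + 1) = 0\<close>, summation by parts leaves that multiple of
  \<open>\<Sum>n\<le>N. U n\<close>.
\<close>

lemma qpoch_Suc: "qpoch x q (Suc n) = qpoch x q n * (1 - x * q ^ n)"
  by (simp add: qpoch_def)

lemma qpoch_Suc_shift: "qpoch x q (Suc n) = (1 - x) * qpoch (q * x) q n"
  unfolding qpoch_def prod.lessThan_Suc_shift by (simp add: mult_ac)

lemma qpochs_Nil [simp]: "qpochs [] q n = 1"
  by (simp add: qpochs_def)

lemma qpochs_Cons [simp]: "qpochs (x # xs) q n = qpoch x q n * qpochs xs q n"
  by (simp add: qpochs_def)

lemma qpochs_Suc: "qpochs xs q (Suc n) = qpochs xs q n * (\<Prod>x\<leftarrow>xs. 1 - x * q ^ n)"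
  by (induction xs) (simp_all add: qpoch_Suc mult_ac)

lemma qpochs_Suc_shift:
  "qpochs xs q (Suc n) = (\<Prod>x\<leftarrow>xs. 1 - x) * qpochs (map ((*) q) xs) q n"
  by (induction xs) (simp_all add: qpoch_Suc_shift mult_ac)

text \<open>Both sides are \<open>qpoch x q (Suc n)\<close>, with the first or the last factor split
  off. The division-free form also covers \<open>x = 1\<close>.\<close>

lemma qpoch_shift: "(1 - x) * qpoch (q * x) q n = qpoch x q n * (1 - x * q ^ n)"
  by (metis qpoch_Suc qpoch_Suc_shift)

lemma qpoch_inverse_power_eq_0:
  assumes "q \<noteq> 0"
  shows "qpoch (q powi (- int N)) q (Suc N) = 0"
  using assms by (simp add: qpoch_Suc power_int_minus)

text \<open>For each of \<open>s\<close> and \<open>- s\<close>, the shift by \<open>q\<close>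
  trades the factor of index 0 for the one of index \<open>n\<close>. The two signs combine through
  (1 - s x)(1 + s x) = 1 - k x^2, taken at x = 1 and at x = q^n.\<close>

lemma very_well_poised_factor:
  assumes "s ^ 2 = k" "k \<noteq> 1" "qpoch s q n \<noteq> 0" "qpoch (- s) q n \<noteq> 0"
  shows "qpoch (q * s) q n * qpoch (- q * s) q n / (qpoch s q n * qpoch (- s) q n)
    = (1 - k * (q ^ n) ^ 2) / (1 - k)"
proof -
  have "(1 - k) * (qpoch (q * s) q n * qpoch (- q * s) q n)
      = ((1 - s) * qpoch (q * s) q n) * ((1 - (- s)) * qpoch (q * (- s)) q n)"
    by (simp flip: assms(1) add: power2_eq_square algebra_simps)
  also have "\<dots> = (1 - k * (q ^ n) ^ 2) * (qpoch s q n * qpoch (- s) q n)"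
    unfolding qpoch_shift by (simp flip: assms(1) add: power2_eq_square algebra_simps)
  finally show ?thesis
    using assms by (simp add: frac_eq_eq mult_ac)
qed

text \<open>Both products are quartics in \<open>x\<close>. Under the balancing condition, replacing
  each parameter by \<open>k\<close> over it preserves the second and fourth elementary symmetric
  functions and exchanges the first and third up to a factor \<open>k\<close>. Hence only the terms
  in x and x^3 survive, and their coefficients have ratio -k.\<close>

lemma balanced_diff:
  fixes a b c d k x :: "'a :: field"
  assumes "k \<noteq> 0" and bal: "a * b * c * d = k ^ 2"
  shows "(1 - k / a * x) * (1 - k / b * x) * (1 - k / c * x) * (1 - k / d * x)
      - (1 - a * x) * (1 - b * x) * (1 - c * x) * (1 - d * x)
    = (a + b + c + d - k / a - k / b - k / c - k / d) * x * (1 - k * x ^ 2)"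
proof -
  have nz: "a \<noteq> 0" "b \<noteq> 0" "c \<noteq> 0" "d \<noteq> 0"
    using assms by auto
  \<comment> \<open>Treating the quotients as atoms leaves polynomial arithmetic without
    division.\<close>
  define a' b' c' d' where "a' = k / a" "b' = k / b" "c' = k / c" "d' = k / d"
  note prime = this
  have inv: "a * a' = k" "b * b' = k" "c * c' = k" "d * d' = k"
    using nz by (simp_all add: prime)
  \<comment> \<open>Complementary pairs: a' b' = k^2 / (a b) = c d. This carries the whole use of
    the balancing condition for the middle coefficients.\<close>
  have e2: "a' * b' = c * d" "a' * c' = b * d" "a' * d' = b * c"
      "b' * c' = a * d" "b' * d' = a * c" "c' * d' = a * b"
    unfolding prime using nz bal
    by (simp_all add: divide_eq_eq power2_eq_square mult_ac)
  have e3: "a' * b' * c' = k * d" "a' * b' * d' = k * c" "a' * c' * d' = k * b" "b' * c' * d' = k * a"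
    unfolding e2 using inv by (simp_all add: mult_ac)
  have e3': "a * b * c = k * d'" "a * b * d = k * c'" "a * c * d = k * b'" "b * c * d = k * a'"
    using inv by (simp_all flip: e2 add: mult_ac)
  have e4: "a' * b' * c' * d' = k ^ 2"
    unfolding e3 using inv by (simp add: power2_eq_square mult_ac)
  have expand: "(1 - p * x) * (1 - r * x) * (1 - s * x) * (1 - t * x)
      = 1 - (p + r + s + t) * x + (p * r + p * s + p * t + r * s + r * t + s * t) * x ^ 2
        - (p * r * s + p * r * t + p * s * t + r * s * t) * x ^ 3 + p * r * s * t * x ^ 4"
    for p r s t :: 'a
    by (simp add: power2_eq_square power3_eq_cube power4_eq_xxxx algebra_simps)
  have "a' * b' + a' * c' + a' * d' + b' * c' + b' * d' + c' * d'
      = a * b + a * c + a * d + b * c + b * d + c * d"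
    unfolding e2 by (simp add: mult_ac)
  then show ?thesis
    unfolding prime[symmetric] expand e4 e3 e3' bal
    by (simp add: power2_eq_square power3_eq_cube algebra_simps)
qed

text \<open>Eliminating \<open>d\<close> by the balancing condition turns the left side into the
  eight terms of the expanded product. The factored form shows when the coefficient from
  \<open>balanced_diff\<close> is nonzero.\<close>

lemma balanced_factorization:
  fixes a b c d k :: "'a :: field"
  assumes "k \<noteq> 0" and bal: "a * b * c * d = k ^ 2"
  shows "a + b + c + d - k / a - k / b - k / c - k / d
    = - (a * b * c / k) * (1 - k / (a * b)) * (1 - k / (a * c)) * (1 - k / (b * c))"
proof -
  have nz: "a \<noteq> 0" "b \<noteq> 0" "c \<noteq> 0" "d \<noteq> 0"
    using assms by auto
  have "k / d = a * b * c / k" "d = k ^ 2 / (a * b * c)"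
    using nz \<open>k \<noteq> 0\<close> by (simp_all add: frac_eq_eq eq_divide_eq bal[symmetric] mult_ac flip: power2_eq_square)
  moreover have "- (a * b * c / k) * (1 - k / (a * b)) * (1 - k / (a * c)) * (1 - k / (b * c))
      = a + b + c - k / a - k / b - k / c - a * b * c / k + k ^ 2 / (a * b * c)"
    using nz \<open>k \<noteq> 0\<close> by (simp add: field_simps power2_eq_square)
  ultimately show ?thesis
    by (simp add: algebra_simps)
qed

text \<open>Splitting the last factors off \<open>U (Suc n)\<close> gives a difference whose
  numerator is \<open>balanced_diff\<close> at x = q^n. Splitting the first factors off the same
  denominator instead produces the q-shifted one.\<close>

lemma balanced_telescope:
  fixes a b c d k q :: complex
  defines "U \<equiv> \<lambda>n. qpochs [a, b, c, d] q n / qpochs [k / a, k / b, k / c, k / d] q n"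
  assumes k: "k \<noteq> 0" and bal: "a * b * c * d = k ^ 2"
    and F: "(1 - k / a) * (1 - k / b) * (1 - k / c) * (1 - k / d) \<noteq> 0"
    and P: "qpochs [k / a, k / b, k / c, k / d] q n \<noteq> 0"
    and Q: "qpochs [q * k / a, q * k / b, q * k / c, q * k / d] q n \<noteq> 0"
  shows "(a + b + c + d - k / a - k / b - k / c - k / d)
      * ((1 - k * (q ^ n) ^ 2) * q ^ n * qpochs [a, b, c, d] q n
        / qpochs [q * k / a, q * k / b, q * k / c, q * k / d] q n)
    = (1 - k / a) * (1 - k / b) * (1 - k / c) * (1 - k / d) * (U n - U (Suc n))"
proof -
  define x where "x = q ^ n"
  define R where "R = qpochs [a, b, c, d] q n"
  define P where "P = qpochs [k / a, k / b, k / c, k / d] q n"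
  define Q where "Q = qpochs [q * k / a, q * k / b, q * k / c, q * k / d] q n"
  define F where "F = (1 - k / a) * (1 - k / b) * (1 - k / c) * (1 - k / d)"
  define A where "A = (1 - a * x) * (1 - b * x) * (1 - c * x) * (1 - d * x)"
  define B where "B = (1 - k / a * x) * (1 - k / b * x) * (1 - k / c * x) * (1 - k / d * x)"
  have num: "qpochs [a, b, c, d] q (Suc n) = R * A"
    unfolding qpochs_Suc by (simp add: R_def A_def x_def mult_ac)
  have den: "qpochs [k / a, k / b, k / c, k / d] q (Suc n) = P * B"
    unfolding qpochs_Suc by (simp add: P_def B_def x_def mult_ac)
  have "qpochs [k / a, k / b, k / c, k / d] q (Suc n) = F * Q"
    unfolding qpochs_Suc_shift by (simp add: F_def Q_def mult_ac)
  with den have PB: "P * B = F * Q"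
    by simp
  have ne: "F \<noteq> 0" "P \<noteq> 0" "Q \<noteq> 0"
    using assms by (simp_all only: F_def P_def Q_def not_False_eq_True)
  \<comment> \<open>The denominator of \<open>U (Suc n)\<close> also equals \<open>F * Q\<close>, so
    it is nonzero even when \<open>n\<close> is the last index of the sum.\<close>
  have B: "B \<noteq> 0"
    using PB ne by auto
  have "U n - U (Suc n) = R / P - R * A / (P * B)"
    by (simp only: U_def num den R_def P_def)
  also have "\<dots> = R * (B - A) / (P * B)"
    using ne B by (simp add: field_simps)
  finally have "F * (U n - U (Suc n)) = R * (B - A) / Q"
    using ne by (simp add: PB)
  moreover have "B - A = (a + b + c + d - k / a - k / b - k / c - k / d) * x * (1 - k * x ^ 2)"
    unfolding A_def B_def by (rule balanced_diff) (use k bal in auto)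
  ultimately show ?thesis
    by (simp add: F_def Q_def R_def x_def mult_ac)
qed

lemma sum_weighted_diff:
  fixes U :: "nat \<Rightarrow> 'a :: comm_ring_1"
  shows "(\<Sum>n=0..N. (of_nat n + 1) * (U n - U (Suc n)))
    = (\<Sum>n=0..N. U n) - (of_nat N + 1) * U (Suc N)"
  by (induction N) (simp_all add: algebra_simps)

theorem corollary4:
  fixes q k y z sqrtk :: complex and N :: nat
  assumes "N > 0"
    and "q \<noteq> 0" and "k \<noteq> 0" and "y \<noteq> 0" and "z \<noteq> 0"
    and "sqrtk ^ 2 = k"
    and "\<And>n. n \<le> N \<Longrightarrow>
      qpochs [sqrtk, - sqrtk, q * k / y, q * k / z, y * z * q powi (1 - int N) / k, k * q ^ (1 + N)] q n \<noteq> 0"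
    and "(1 - k) * (1 - k / (y * z)) * (1 - k * q ^ N / y) * (1 - k * q ^ N / z) \<noteq> 0"
    and "\<And>n. n \<le> N \<Longrightarrow>
      qpochs [k / y, k / z, k * q ^ N, y * z * q powi (- int N) / k] q n \<noteq> 0"
  shows "(\<Sum>n=0..N.
      qpochs [q * sqrtk, - q * sqrtk, y, z, k ^ 2 * q ^ N / (y * z), q powi (- int N)] q n
        * (of_nat n + 1) * q ^ n
      / qpochs [sqrtk, - sqrtk, q * k / y, q * k / z, y * z * q powi (1 - int N) / k, k * q ^ (1 + N)] q n)
    = ((1 - k / y) * (1 - k / z) * (1 - k * q ^ N) * (1 - k * q ^ N / (y * z)))
      / ((1 - k) * (1 - k / (y * z)) * (1 - k * q ^ N / y) * (1 - k * q ^ N / z))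
      * (\<Sum>n=0..N.
          qpochs [y, z, k ^ 2 * q ^ N / (y * z), q powi (- int N)] q n
          / qpochs [k / y, k / z, k * q ^ N, y * z * q powi (- int N) / k] q n)"
proof -
  define v where "v = q powi (- int N)"
  define w where "w = k ^ 2 * q ^ N / (y * z)"
  define U where "U = (\<lambda>n. qpochs [y, z, v, w] q n / qpochs [k / y, k / z, k / v, k / w] q n)"
  define T where "T = (\<lambda>n. (1 - k * (q ^ n) ^ 2) * q ^ n * qpochs [y, z, v, w] q n
    / qpochs [q * k / y, q * k / z, q * k / v, q * k / w] q n)"
  define E where "E = y + z + v + w - k / y - k / z - k / v - k / w"
  define F where "F = (1 - k / y) * (1 - k / z) * (1 - k / v) * (1 - k / w)"
  note q = \<open>q \<noteq> 0\<close> and k = \<open>k \<noteq> 0\<close> and y = \<open>y \<noteq> 0\<close> and z = \<open>z \<noteq> 0\<close>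
  have v: "v \<noteq> 0" and qN: "q ^ N = 1 / v"
    using q by (simp_all add: v_def power_int_minus divide_simps)
  have bal: "y * z * v * w = k ^ 2"
    using q y z v by (simp add: w_def qN)
  \<comment> \<open>These identities reveal the well-poised structure: each of \<open>y\<close>,
    \<open>z\<close>, \<open>v\<close>, \<open>w\<close> is paired with \<open>k\<close> over it on
    the right and with \<open>q * k\<close> over it on the left.\<close>
  have kv: "k / v = k * q ^ N" "q * k / v = k * q ^ (1 + N)"
    by (simp_all add: qN)
  have q1: "q powi (1 - int N) = q * v"
    using q by (simp add: v_def power_int_diff power_int_minus divide_inverse)
  have kw: "k / w = y * z * v / k" "q * k / w = y * z * q powi (1 - int N) / k"
    using q k y z v by (simp_all add: q1 w_def qN power2_eq_square)
  have left_den: "qpochs [sqrtk, - sqrtk] q n \<noteq> 0"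
      "qpochs [q * k / y, q * k / z, q * k / v, q * k / w] q n \<noteq> 0" if "n \<le> N" for n
    using assms(7)[OF that] by (simp_all add: kv(2) kw(2))
  have right_den: "qpochs [k / y, k / z, k / v, k / w] q n \<noteq> 0" if "n \<le> N" for n
    using assms(9)[OF that] unfolding kv(1) kw(1) unfolding v_def .
  \<comment> \<open>\<open>F\<close> is the right-hand denominator at n = 1, an index in range
    because \<open>N > 0\<close>.\<close>
  have F: "F \<noteq> 0"
    using right_den[of 1] \<open>N > 0\<close> by (simp add: F_def qpoch_def)
  have k1: "1 - k \<noteq> 0"
    using assms(8) by auto
  \<comment> \<open>With \<open>w\<close> as the eliminated parameter, the pairs from
    \<open>y\<close>, \<open>z\<close>, \<open>v\<close> give exactly the wanted factors, since k /
    (y v) = k q^N / y and likewise for \<open>z\<close>.\<close>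
  have E_eq: "E = - (y * z * v / k) * (1 - k / (y * z)) * (1 - k * q ^ N / y) * (1 - k * q ^ N / z)"
    unfolding E_def using balanced_factorization[OF k bal] by (simp add: qN mult_ac)
  have E: "E \<noteq> 0"
    using assms(8) y z v k unfolding E_eq by simp
  \<comment> \<open>\<open>k / w\<close> is the reciprocal of k q^N / (y z). Inverting it brings out
    the same factor -(y z v / k) as in \<open>E_eq\<close>, and the two cancel in
    \<open>factor\<close>.\<close>
  have "1 - k / w = - (y * z * v / k) * (1 - k * q ^ N / (y * z))"
    unfolding kw(1) using k y z v by (simp add: qN field_simps)
  then have factor: "((1 - k / y) * (1 - k / z) * (1 - k * q ^ N) * (1 - k * q ^ N / (y * z)))
      / ((1 - k) * (1 - k / (y * z)) * (1 - k * q ^ N / y) * (1 - k * q ^ N / z)) = F / ((1 - k) * E)"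
    unfolding F_def E_eq kv(1) using k y z v by (simp add: mult.assoc)
  have summand: "qpochs [q * sqrtk, - q * sqrtk, y, z, k ^ 2 * q ^ N / (y * z), q powi (- int N)] q n
        * (of_nat n + 1) * q ^ n
      / qpochs [sqrtk, - sqrtk, q * k / y, q * k / z, y * z * q powi (1 - int N) / k, k * q ^ (1 + N)] q n
    = F / ((1 - k) * E) * ((of_nat n + 1) * (U n - U (Suc n)))" (is "?t = _") if "n \<le> N" for n
  proof -
    have "?t = qpoch (q * sqrtk) q n * qpoch (- q * sqrtk) q n / (qpoch sqrtk q n * qpoch (- sqrtk) q n)
        * ((of_nat n + 1) * q ^ n * qpochs [y, z, v, w] q n
          / qpochs [q * k / y, q * k / z, q * k / v, q * k / w] q n)"
      unfolding v_def[symmetric] w_def[symmetric] kv(2)[symmetric] kw(2)[symmetric]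
      by (simp add: mult_ac)
    also have "\<dots> = (of_nat n + 1) * T n / (1 - k)"
      using left_den(1)[OF that] k1 assms(6)
      by (subst very_well_poised_factor[where k = k]) (auto simp: T_def mult_ac)
    also have "T n = F * (U n - U (Suc n)) / E"
      using balanced_telescope[OF k bal F[unfolded F_def] right_den left_den(2), OF that that] E
      by (simp add: T_def E_def F_def U_def field_simps)
    finally show ?thesis
      by (simp add: mult_ac)
  qed
  \<comment> \<open>The numerator contains (v; q) of length N + 1, whose factor of index
    \<open>N\<close> is 1 - q^(-N) q^N = 0.\<close>
  have "U (Suc N) = 0"
    using q by (simp add: U_def v_def qpoch_inverse_power_eq_0 del: power_int_minus)
  then have parts: "(\<Sum>n=0..N. (of_nat n + 1) * (U n - U (Suc n))) = (\<Sum>n=0..N. U n)"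
    by (simp add: sum_weighted_diff)
  have U_eq: "U n = qpochs [y, z, k ^ 2 * q ^ N / (y * z), q powi (- int N)] q n
      / qpochs [k / y, k / z, k * q ^ N, y * z * q powi (- int N) / k] q n" for n
    unfolding U_def v_def[symmetric] w_def[symmetric] kv(1)[symmetric] kw(1)[symmetric]
    by (simp add: mult_ac)
  \<comment> \<open>Summation by parts is applied backwards to the right-hand sum, so that the two
    sides agree term by term.\<close>
  show ?thesis
    unfolding factor U_eq[symmetric] parts[symmetric] sum_distrib_left
    by (intro sum.cong refl summand) simp
qed

end
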